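(* Let $\alpha\in[0,1)$ and let $D$ be a digraph with $n\ge 2$ vertices, outdegrees $d_1^+,\dots,d_n^+$, and $a$ arcs, where $a\ge n\beta$ with $\beta=\max(1-\alpha,\ \alpha\, d^+_{\max})$ and $d^+_{\max}=\max_i d_i^+$. Then $$\|D_\alpha\|_*\le \frac an+\sqrt{(n-1)\Big[(1-\alpha)^2a+\alpha^2\sum_{i=1}^n (d_i^+)^2-\frac{a^2}{n^2}\Big]},$$ with equality if and only if $D$ satisfies one of the following: (a) $\alpha=0$ and $D$ is a direct sum (vertex-disjoint union) of directed cycles; (b) $D$ is $\frac an$-regular and $A_\alpha(D)$ has exactly two distinct (nonnegative) singular values, namely $\sigma_{1\alpha}=\frac an$ and $\sigma_{2\alpha}=\sigma_{3\alpha}=\dots=\sigma_{n\alpha}=\sigma$, where $$\sigma=\sqrt{\frac{\alpha^2\sum_{i=1}^n (d_i^+)^2+(1-\alpha)^2a-\frac{a^2}{n^2}}{n-1}}.$$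
   Context: Digraphs are simple: a finite vertex set and a set of arcs, which are ordered pairs of distinct vertices, with no parallel arcs (a pair of opposite arcs is allowed). A directed cycle of order $m\ge2$ has vertices $w_1,\dots,w_m$ and arcs $(w_1,w_2),\dots,(w_{m-1},w_m),(w_m,w_1)$. A digraph is $k$-regular if every vertex has outdegree $k$ and indegree $k$. For a digraph $D$ on vertices $v_1,\dots,v_n$, the adjacency matrix $A(D)=(a_{ij})$ has $a_{ij}=1$ if $(v_i,v_j)$ is an arc and $0$ otherwise; $d_i^+$ is the outdegree of $v_i$, and $\Delta^+(D)=\mathrm{diag}(d_1^+,\dots,d_n^+)$. For $\alpha\in[0,1)$, $A_\alpha(D)=\alpha\Delta^+(D)+(1-\alpha)A(D)$. Its singular values $\sigma_{1\alpha}\ge\sigma_{2\alpha}\ge\dots\ge\sigma_{n\alpha}\ge0$ are the nonnegative square roots of the eigenvalues of $A_\alpha(D)A_\alpha(D)^T$, and $\|D_\alpha\|_*=\sum_{i=1}^n\sigma_{i\alpha}$. *)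

theory Defs
  imports Complex_Main "Jordan_Normal_Form.Char_Poly"
begin

definition digraph :: "nat \<Rightarrow> (nat \<times> nat) set \<Rightarrow> bool" where
  "digraph n Arcs \<longleftrightarrow> Arcs \<subseteq> {0..<n} \<times> {0..<n} \<and> (\<forall>i. (i, i) \<notin> Arcs)"

definition outdeg :: "(nat \<times> nat) set \<Rightarrow> nat \<Rightarrow> nat" where
  "outdeg Arcs i = card {j. (i, j) \<in> Arcs}"

definition indeg :: "(nat \<times> nat) set \<Rightarrow> nat \<Rightarrow> nat" where
  "indeg Arcs i = card {j. (j, i) \<in> Arcs}"

definition max_outdeg :: "nat \<Rightarrow> (nat \<times> nat) set \<Rightarrow> nat" where
  "max_outdeg n Arcs = Max (outdeg Arcs ` {0..<n})"

definition adj_mat :: "nat \<Rightarrow> (nat \<times> nat) set \<Rightarrow> real mat" where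
  "adj_mat n Arcs = mat n n (\<lambda>(i, j). if (i, j) \<in> Arcs then 1 else 0)"

definition outdeg_mat :: "nat \<Rightarrow> (nat \<times> nat) set \<Rightarrow> real mat" where
  "outdeg_mat n Arcs = mat n n (\<lambda>(i, j). if i = j then real (outdeg Arcs i) else 0)"

definition A_alpha :: "real \<Rightarrow> nat \<Rightarrow> (nat \<times> nat) set \<Rightarrow> real mat" where
  "A_alpha \<alpha> n Arcs = \<alpha> \<cdot>\<^sub>m outdeg_mat n Arcs + (1 - \<alpha>) \<cdot>\<^sub>m adj_mat n Arcs"

definition singular_values :: "real mat \<Rightarrow> real list" where
  "singular_values M = (THE s. length s = dim_row M \<and> sorted_wrt (\<ge>) s \<and> (\<forall>x\<in>set s. x \<ge> 0) \<and>
      char_poly (M * transpose_mat M) = prod_list (map (\<lambda>x. [:- (x^2), 1:]) s))"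

definition nuclear_norm :: "real mat \<Rightarrow> real" where
  "nuclear_norm M = sum_list (singular_values M)"

definition regular :: "nat \<Rightarrow> (nat \<times> nat) set \<Rightarrow> real \<Rightarrow> bool" where
  "regular n Arcs k \<longleftrightarrow> (\<forall>i<n. real (outdeg Arcs i) = k \<and> real (indeg Arcs i) = k)"

definition cycle_arcs :: "nat list \<Rightarrow> (nat \<times> nat) set" where
  "cycle_arcs ws = {(ws ! k, ws ! ((k + 1) mod length ws)) | k. k < length ws}"

definition direct_sum_of_cycles :: "nat \<Rightarrow> (nat \<times> nat) set \<Rightarrow> bool" where
  "direct_sum_of_cycles n Arcs \<longleftrightarrow>
     (\<exists>C :: nat list set. finite C \<and>
        (\<forall>ws\<in>C. distinct ws \<and> length ws \<ge> 2) \<and>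
        (\<forall>ws\<in>C. \<forall>vs\<in>C. ws \<noteq> vs \<longrightarrow> set ws \<inter> set vs = {}) \<and>
        (\<Union>ws\<in>C. set ws) = {0..<n} \<and>
        Arcs = (\<Union>ws\<in>C. cycle_arcs ws))"

end

theory Submission
  imports Defs "Jordan_Normal_Form.Schur_Decomposition" "HOL-Analysis.L2_Norm"
    "HOL-Combinatorics.Cycles"
begin

text \<open>
  Write \<open>t = a / n\<close> and let \<open>F\<close> be the squared Frobenius norm of \<open>A\<^sub>\<alpha>\<close>, which is the sum of
  the squared singular values. The rows of \<open>A\<^sub>\<alpha>\<close> sum to the outdegrees, so evaluating
  \<open>A\<^sub>\<alpha> A\<^sub>\<alpha>\<^sup>T\<close> at the all-ones vector gives \<open>\<sigma>\<^sub>1 \<ge> t\<close>. All entries lie between \<open>0\<close> and \<open>\<beta>\<close>,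
  so \<open>F \<le> \<beta> a \<le> n t\<^sup>2\<close>, i.e. \<open>\<sigma> \<le> t\<close>. If the sum of the singular values reaches
  \<open>t + (n - 1) \<sigma>\<close>, then \<open>(\<sigma>\<^sub>1 - t)\<^sup>2 + \<Sum>\<^sub>i\<^sub>\<ge>\<^sub>2 (\<sigma>\<^sub>i - \<sigma>)\<^sup>2 \<le> 2 (t - \<sigma>) (t - \<sigma>\<^sub>1) \<le> 0\<close>, which gives
  the bound and the singular values in the case of equality. There \<open>\<sigma>\<^sub>1 = t\<close> makes the
  all-ones vector a left and right singular vector, hence \<open>D\<close> regular of degree \<open>t\<close>; if moreover \<open>\<sigma> = t\<close>, then \<open>F = n t\<^sup>2\<close> reads
  \<open>(1 + \<alpha>) t = 1 - \<alpha>\<close>, so \<open>\<alpha> = 0\<close>, \<open>t = 1\<close>, and a \<open>1\<close>-regular digraph is a union of cycles.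
\<close>

section \<open>Singular values\<close>

lemma scalar_prod_self_nonneg: "0 \<le> (v::real vec) \<bullet> v"
  using conjugate_square_ge_0_vec[of v] by simp

lemma gram_quadratic_form:
  fixes M :: "'a::comm_semiring_0 mat"
  assumes M: "M \<in> carrier_mat n m" and x: "x \<in> carrier_vec n" and y: "y \<in> carrier_vec n"
  shows "x \<bullet> ((M * M\<^sup>T) *\<^sub>v y) = (M\<^sup>T *\<^sub>v x) \<bullet> (M\<^sup>T *\<^sub>v y)"
  using transpose_vec_mult_scalar[OF M _ x, of "M\<^sup>T *\<^sub>v y"] M y by simp

text \<open>Stated over the complex numbers because only there does the characteristic polynomial
  split a priori. For an eigenvector \<open>v\<close> and \<open>w = N\<^sup>T *\<^sub>v v\<close>,
  realness of \<open>N\<close> lets conjugation pass through \<open>N\<^sup>T\<close>, so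
  \<open>a\<close> times the squared norm of \<open>v\<close> is the squared norm of
  \<open>w\<close>.\<close>

lemma eigenvalue_gram_nonneg:
  fixes M :: "real mat"
  assumes M: "M \<in> carrier_mat n m"
    and ev: "eigenvalue (map_mat complex_of_real (M * M\<^sup>T)) a"
  shows "a \<in> \<real> \<and> 0 \<le> Re a"
proof -
  define N where "N = map_mat complex_of_real M"
  have N: "N \<in> carrier_mat n m" using M by (simp add: N_def)
  have gram: "map_mat complex_of_real (M * M\<^sup>T) = N * N\<^sup>T"
    unfolding N_def by (subst of_real_hom.mat_hom_mult[OF M]) (use M in \<open>auto simp: map_mat_transpose\<close>)
  obtain v where v: "v \<in> carrier_vec n" "v \<noteq> 0\<^sub>v n" "(N * N\<^sup>T) *\<^sub>v v = a \<cdot>\<^sub>v v"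
    using ev N unfolding eigenvalue_def eigenvector_def gram by auto
  define w where "w = N\<^sup>T *\<^sub>v v"
  have w: "w \<in> carrier_vec m" unfolding w_def by (rule mult_mat_vec_carrier) (use N v in auto)
  have conj: "N\<^sup>T *\<^sub>v conjugate v = conjugate w"
  proof (rule eq_vecI)
    fix i assume "i < dim_vec (conjugate w)"
    then have i: "i < m" using N by (simp add: w_def)
    have "conjugate (row N\<^sup>T i) = row N\<^sup>T i"
      by (rule eq_vecI) (use M i in \<open>auto simp: N_def\<close>)
    then show "(N\<^sup>T *\<^sub>v conjugate v) $ i = conjugate w $ i"
      using i N v conjugate_sprod_vec[of "row N\<^sup>T i" n v] by (simp add: w_def)
  qed (use N in \<open>simp add: w_def\<close>)
  have "a * (v \<bullet>c v) = conjugate v \<bullet> ((N * N\<^sup>T) *\<^sub>v v)"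
    using v by (simp add: comm_scalar_prod[of "conjugate v" n v])
  also have "\<dots> = conjugate w \<bullet> w"
    by (subst gram_quadratic_form[OF N]) (use v in \<open>auto simp: conj w_def\<close>)
  also have "\<dots> = w \<bullet>c w"
    by (rule comm_scalar_prod[of _ m]) (use w in auto)
  finally have eq: "a * (v \<bullet>c v) = w \<bullet>c w" .
  have "0 < v \<bullet>c v" using v by simp
  \<comment> \<open>In the order on the complex numbers, comparability with 0 already forces a zero
    imaginary part.\<close>
  then obtain p where p: "v \<bullet>c v = complex_of_real p" "0 < p"
    by (metis complex_is_Real_iff less_complex_def of_real_Re zero_complex.sel)
  have "0 \<le> w \<bullet>c w" by auto
  then obtain q where q: "w \<bullet>c w = complex_of_real q" "0 \<le> q"
    by (metis complex_is_Real_iff less_eq_complex_def of_real_Re zero_complex.sel)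
  have "a = complex_of_real (q / p)" using eq p q by (simp add: field_simps)
  then show ?thesis using p q by simp
qed

text \<open>All complex roots are real, so the complex factorization is the image of a product of
  real linear factors; injectivity of the embedding of real polynomials brings it back.\<close>

lemma char_poly_gram_factorized:
  fixes M :: "real mat"
  assumes M: "M \<in> carrier_mat n m"
  obtains es where "char_poly (M * M\<^sup>T) = (\<Prod>e\<leftarrow>es. [:- e, 1:])"
    "length es = n" "\<forall>e\<in>set es. 0 \<le> e"
proof -
  let ?G = "M * M\<^sup>T"
  have G: "?G \<in> carrier_mat n n" and G': "map_mat complex_of_real ?G \<in> carrier_mat n n"
    using M by auto
  obtain as where as: "char_poly (map_mat complex_of_real ?G) = (\<Prod>a\<leftarrow>as. [:- a, 1:])"
    "length as = n"
    using char_poly_factorized[OF G'] by blast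
  have real: "a \<in> \<real> \<and> 0 \<le> Re a" if "a \<in> set as" for a
  proof (rule eigenvalue_gram_nonneg[OF M])
    show "eigenvalue (map_mat complex_of_real ?G) a"
      unfolding eigenvalue_root_char_poly[OF G'] as poly_prod_list
      using that by (auto simp: prod_list_zero_iff)
  qed
  interpret of_real_poly: map_poly_inj_comm_ring_hom complex_of_real ..
  have "map_poly complex_of_real (char_poly ?G) = (\<Prod>a\<leftarrow>as. [:- a, 1:])"
    unfolding as(1)[symmetric] by (rule of_real_hom.char_poly_hom[OF G, symmetric])
  also have "\<dots> = (\<Prod>a\<leftarrow>as. map_poly complex_of_real [:- Re a, 1:])"
    by (rule arg_cong[where f = prod_list], rule map_cong)
      (use real in \<open>auto simp: map_poly_pCons\<close>)
  also have "\<dots> = map_poly complex_of_real (\<Prod>e\<leftarrow>map Re as. [:- e, 1:])"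
    by (simp add: of_real_poly.hom_prod_list o_def)
  finally have "char_poly ?G = (\<Prod>e\<leftarrow>map Re as. [:- e, 1:])"
    by (rule of_real_poly.injectivity)
  then show thesis by (rule that) (use as real in auto)
qed

lemma proots_linear_factors:
  fixes es :: "'a::idom list"
  shows "proots (\<Prod>e\<leftarrow>es. [:- e, 1:]) = mset es"
proof (induction es)
  case (Cons e es)
  have "(\<Prod>e\<leftarrow>es. [:- e, 1:]) \<noteq> 0" by (auto simp: prod_list_zero_iff)
  then show ?case using Cons by (simp add: proots_mult del: mult_pCons_left)
qed simp

text \<open>This makes the description in \<open>singular_values\<close> meaningful. The polynomial
  determines the multiset of squares, nonnegativity determines their roots, and the decreasing order
  leaves a single list.\<close>

lemma singular_values_exist_unique:
  fixes M :: "real mat"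
  assumes M: "M \<in> carrier_mat n m"
  shows "\<exists>!s. length s = dim_row M \<and> sorted_wrt (\<ge>) s \<and> (\<forall>x\<in>set s. x \<ge> 0) \<and>
      char_poly (M * M\<^sup>T) = (\<Prod>x\<leftarrow>s. [:- (x^2), 1:])"
proof (rule ex_ex1I)
  obtain es where es: "char_poly (M * M\<^sup>T) = (\<Prod>e\<leftarrow>es. [:- e, 1:])"
    "length es = n" "\<forall>e\<in>set es. 0 \<le> e"
    using char_poly_gram_factorized[OF M] .
  \<comment> \<open>\<open>sort\<close> is increasing, hence the reversal.\<close>
  define s where "s = rev (sort (map sqrt es))"
  have "mset (map (\<lambda>x. x^2) s) = image_mset (\<lambda>x. x^2) (image_mset sqrt (mset es))"
    by (simp add: s_def)
  also have "\<dots> = mset es"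
    using es(3) by (simp add: image_mset.compositionality o_def)
      (metis (no_types, lifting) image_mset_cong multiset.map_ident real_sqrt_pow2 set_mset_mset)
  finally have "mset (map (\<lambda>e. [:- e, 1:]) (map (\<lambda>x. x^2) s)) = mset (map (\<lambda>e. [:- e, 1:]) es)"
    by (metis mset_map)
  then have "(\<Prod>x\<leftarrow>s. [:- (x^2), 1:]) = (\<Prod>e\<leftarrow>es. [:- e, 1:])"
    by (metis (no_types, lifting) map_map o_def map_eq_conv prod_mset_prod_list)
  moreover have "sorted_wrt (\<ge>) s"
    unfolding s_def sorted_wrt_rev by simp
  ultimately show "\<exists>s. length s = dim_row M \<and> sorted_wrt (\<ge>) s \<and> (\<forall>x\<in>set s. x \<ge> 0) \<and>
      char_poly (M * M\<^sup>T) = (\<Prod>x\<leftarrow>s. [:- (x^2), 1:])"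
    using es M by (intro exI[of _ s]) (auto simp: s_def)
next
  fix s t :: "real list"
  let ?P = "\<lambda>s. length s = dim_row M \<and> sorted_wrt (\<ge>) s \<and> (\<forall>x\<in>set s. x \<ge> 0) \<and>
      char_poly (M * M\<^sup>T) = (\<Prod>x\<leftarrow>s. [:- (x^2), 1:])"
  assume s: "?P s" and t: "?P t"
  have roots: "mset u = image_mset sqrt (proots (char_poly (M * M\<^sup>T)))" if "?P u" for u
  proof -
    have "proots (char_poly (M * M\<^sup>T)) = mset (map (\<lambda>x. x^2) u)"
      using proots_linear_factors[of "map (\<lambda>x. x^2) u"] that by (simp add: o_def)
    moreover have "map sqrt (map (\<lambda>x. x^2) u) = u"
      using that by (auto intro!: map_idI)
    ultimately show ?thesis by (metis mset_map)
  qed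
  have rev: "rev u = sort u" if "?P u" for u
    using that properties_for_sort[of "rev u" u] by (simp add: sorted_wrt_rev)
  have "mset s = mset t" using roots[OF s] roots[OF t] by simp
  then have "sort s = sort t" by (metis properties_for_sort mset_sort sorted_sort)
  then have "rev s = rev t" using rev[OF s] rev[OF t] by simp
  then show "s = t" by simp
qed

lemma singular_values:
  fixes M :: "real mat"
  assumes M: "M \<in> carrier_mat n m"
  shows "length (singular_values M) = n"
    and "sorted_wrt (\<ge>) (singular_values M)"
    and "\<forall>x\<in>set (singular_values M). x \<ge> 0"
    and "char_poly (M * M\<^sup>T) = (\<Prod>x\<leftarrow>singular_values M. [:- (x^2), 1:])"
  using theI'[OF singular_values_exist_unique[OF M]] M unfolding singular_values_def by auto

lemma singular_values_eqI:
  fixes M :: "real mat"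
  assumes M: "M \<in> carrier_mat n m"
    and "length s = n" "sorted_wrt (\<ge>) s" "\<forall>x\<in>set s. x \<ge> 0"
      "char_poly (M * M\<^sup>T) = (\<Prod>x\<leftarrow>s. [:- (x^2), 1:])"
  shows "singular_values M = s"
  unfolding singular_values_def
  by (rule the1_equality[OF singular_values_exist_unique[OF M]]) (use assms in auto)

section \<open>The trace and the sum of the squared singular values\<close>

lemma sum_diag_mult_commute:
  fixes A B :: "'a::comm_semiring_0 mat"
  assumes "A \<in> carrier_mat n m" "B \<in> carrier_mat m n"
  shows "(\<Sum>i<n. (A * B) $$ (i, i)) = (\<Sum>j<m. (B * A) $$ (j, j))"
proof -
  have "(\<Sum>i<n. (A * B) $$ (i, i)) = (\<Sum>i<n. \<Sum>j<m. A $$ (i, j) * B $$ (j, i))"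
    using assms by (intro sum.cong) (auto simp: scalar_prod_def atLeast0LessThan)
  also have "\<dots> = (\<Sum>j<m. \<Sum>i<n. B $$ (j, i) * A $$ (i, j))"
    by (subst sum.swap) (simp add: mult.commute)
  also have "\<dots> = (\<Sum>j<m. (B * A) $$ (j, j))"
    using assms by (intro sum.cong) (auto simp: scalar_prod_def atLeast0LessThan)
  finally show ?thesis .
qed

text \<open>A Schur decomposition makes \<open>A\<close> similar to a matrix with diagonal
  \<open>es\<close>, and the trace is invariant under similarity because the two factors of a
  product commute under it.\<close>

lemma sum_eigenvalues_eq_sum_diag:
  fixes A :: "'a::conjugatable_ordered_field mat"
  assumes A: "A \<in> carrier_mat n n" and c: "char_poly A = (\<Prod>e\<leftarrow>es. [:- e, 1:])"
  shows "sum_list es = (\<Sum>i<n. A $$ (i, i))"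
proof -
  obtain B P Q where "schur_decomposition A es = (B, P, Q)"
    using prod_cases3 by blast
  then have sim: "similar_mat_wit A B P Q" and diag: "diag_mat B = es"
    using schur_decomposition[OF A c] by auto
  note wit = similar_mat_witD2[OF A sim]
  have "(\<Sum>i<n. A $$ (i, i)) = (\<Sum>i<n. (Q * (P * B)) $$ (i, i))"
    unfolding wit(3) by (rule sum_diag_mult_commute[of _ n n]) (use wit in auto)
  also have "Q * (P * B) = B"
    using assoc_mult_mat[OF wit(7,6,5)] wit(2,5) by simp
  also have "(\<Sum>i<n. B $$ (i, i)) = sum_list (diag_mat B)"
    using wit by (auto simp: diag_mat_def sum_list_distinct_conv_sum_set atLeast0LessThan)
  finally show ?thesis using diag by simp
qed

lemma sum_singular_values_squares:
  assumes M: "M \<in> carrier_mat n m"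
  shows "(\<Sum>x\<leftarrow>singular_values M. x^2) = (\<Sum>i<n. \<Sum>j<m. (M $$ (i, j))^2)"
proof -
  have "(\<Sum>x\<leftarrow>singular_values M. x^2) = (\<Sum>i<n. (M * M\<^sup>T) $$ (i, i))"
    by (rule sum_eigenvalues_eq_sum_diag) (use M singular_values(4)[OF M] in \<open>auto simp: o_def\<close>)
  also have "\<dots> = (\<Sum>i<n. \<Sum>j<m. (M $$ (i, j))^2)"
    using M by (intro sum.cong) (auto simp: scalar_prod_def power2_eq_square atLeast0LessThan)
  finally show ?thesis .
qed

section \<open>Rayleigh quotients of symmetric real matrices, without an orthonormal
  eigenbasis\<close>

lemma sum_prod_square_le:
  fixes f g :: "'a \<Rightarrow> real"
  shows "(\<Sum>i\<in>I. f i * g i)^2 \<le> (\<Sum>i\<in>I. (f i)^2) * (\<Sum>i\<in>I. (g i)^2)"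
proof -
  have "\<bar>\<Sum>i\<in>I. f i * g i\<bar> \<le> L2_set f I * L2_set g I"
    using sum_abs[of "\<lambda>i. f i * g i" I] L2_set_mult_ineq[of f g I] by (simp add: abs_mult)
  then have "\<bar>\<Sum>i\<in>I. f i * g i\<bar>^2 \<le> (L2_set f I * L2_set g I)^2"
    by (rule power_mono) simp
  then show ?thesis
    by (simp add: L2_set_def power_mult_distrib sum_nonneg)
qed

lemma mult_mat_vec_bounded:
  fixes A :: "real mat"
  assumes A: "A \<in> carrier_mat n m"
  obtains C where "0 < C" "\<And>x. x \<in> carrier_vec m \<Longrightarrow> (A *\<^sub>v x) \<bullet> (A *\<^sub>v x) \<le> C * (x \<bullet> x)"
proof
  \<comment> \<open>The squared Frobenius norm works, by Cauchy-Schwarz in each row. The 1 added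
    below makes the constant positive even for the zero matrix.\<close>
  define C where "C = (\<Sum>i<n. \<Sum>j<m. (A $$ (i, j))^2)"
  have "0 \<le> C" unfolding C_def by (intro sum_nonneg) auto
  then show "0 < C + 1" by simp
  fix x :: "real vec" assume x: "x \<in> carrier_vec m"
  have xx: "x \<bullet> x = (\<Sum>j<m. (x $ j)^2)"
    using x by (simp add: scalar_prod_def power2_eq_square atLeast0LessThan)
  have "(A *\<^sub>v x) \<bullet> (A *\<^sub>v x) = (\<Sum>i<n. (\<Sum>j<m. A $$ (i, j) * x $ j)^2)"
    using A x by (simp add: scalar_prod_def power2_eq_square atLeast0LessThan)
  also have "\<dots> \<le> (\<Sum>i<n. (\<Sum>j<m. (A $$ (i, j))^2) * (\<Sum>j<m. (x $ j)^2))"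
    by (intro sum_mono sum_prod_square_le)
  also have "\<dots> = C * (x \<bullet> x)" by (simp add: C_def xx sum_distrib_right)
  also have "\<dots> \<le> (C + 1) * (x \<bullet> x)"
    using scalar_prod_self_nonneg[of x] by (simp add: algebra_simps)
  finally show "(A *\<^sub>v x) \<bullet> (A *\<^sub>v x) \<le> (C + 1) * (x \<bullet> x)" .
qed

text \<open>A small value of the form forces a small image. This serves twice: it makes a
  nonsingular form coercive, and it turns a vanishing form into a kernel vector.\<close>

lemma psd_form_controls_image:
  fixes L :: "real mat"
  assumes L: "L \<in> carrier_mat n n" and sym: "L\<^sup>T = L"
    and psd: "\<And>x. x \<in> carrier_vec n \<Longrightarrow> 0 \<le> x \<bullet> (L *\<^sub>v x)"
    and "0 < C" and bound: "\<And>x. x \<in> carrier_vec n \<Longrightarrow> x \<bullet> (L *\<^sub>v x) \<le> C * (x \<bullet> x)"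
    and x: "x \<in> carrier_vec n"
  shows "(L *\<^sub>v x) \<bullet> (L *\<^sub>v x) \<le> C * (x \<bullet> (L *\<^sub>v x))"
proof -
  define y where "y = L *\<^sub>v x"
  define s where "s = 1 / C"
  have y: "y \<in> carrier_vec n" and Ly: "L *\<^sub>v y \<in> carrier_vec n"
    using L x by (auto simp: y_def)
  have cross: "x \<bullet> (L *\<^sub>v y) = y \<bullet> y"
    using transpose_vec_mult_scalar[OF L y x] by (simp add: sym y_def)
  \<comment> \<open>Positivity of the form at \<open>x - L x / C\<close>.\<close>
  have "0 \<le> (x + (- s) \<cdot>\<^sub>v y) \<bullet> (L *\<^sub>v (x + (- s) \<cdot>\<^sub>v y))"
    by (rule psd) (use x y in auto)
  also have "L *\<^sub>v (x + (- s) \<cdot>\<^sub>v y) = y + (- s) \<cdot>\<^sub>v (L *\<^sub>v y)"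
    using L x y by (simp add: mult_add_distrib_mat_vec[OF L] mult_mat_vec[OF L] y_def)
  also have "(x + (- s) \<cdot>\<^sub>v y) \<bullet> (y + (- s) \<cdot>\<^sub>v (L *\<^sub>v y)) =
      x \<bullet> y - s * (x \<bullet> (L *\<^sub>v y)) - s * (y \<bullet> y) + s^2 * (y \<bullet> (L *\<^sub>v y))"
    using x y Ly
    by (simp add: add_scalar_prod_distrib[of _ n] scalar_prod_add_distrib[of _ n]
        power2_eq_square algebra_simps)
  also have "\<dots> \<le> x \<bullet> y - 2 * s * (y \<bullet> y) + s^2 * (C * (y \<bullet> y))"
    using mult_left_mono[OF bound[OF y], of "s^2"] by (simp add: cross)
  also have "\<dots> = x \<bullet> y - (y \<bullet> y) / C"
    using \<open>0 < C\<close> by (simp add: s_def power2_eq_square field_simps)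
  finally show ?thesis using \<open>0 < C\<close> by (simp add: y_def field_simps)
qed

text \<open>The inverse bounds \<open>x\<close> by its image under \<open>L\<close>, and
  \<open>psd_form_controls_image\<close> bounds that image by the form; the product of the two
  constants gives \<epsilon>.\<close>

lemma psd_nonsingular_coercive:
  fixes L :: "real mat"
  assumes L: "L \<in> carrier_mat n n" and sym: "L\<^sup>T = L"
    and psd: "\<And>x. x \<in> carrier_vec n \<Longrightarrow> 0 \<le> x \<bullet> (L *\<^sub>v x)"
    and "0 < C" and bound: "\<And>x. x \<in> carrier_vec n \<Longrightarrow> x \<bullet> (L *\<^sub>v x) \<le> C * (x \<bullet> x)"
    and det: "det L \<noteq> 0"
  obtains \<epsilon> where "0 < \<epsilon>" "\<And>x. x \<in> carrier_vec n \<Longrightarrow> \<epsilon> * (x \<bullet> x) \<le> x \<bullet> (L *\<^sub>v x)"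
proof -
  obtain B where B: "B \<in> carrier_mat n n" "B * L = 1\<^sub>m n"
    using det_non_zero_imp_unit[OF L det] by (auto simp: Units_def ring_mat_def)
  obtain K where K: "0 < K" "\<And>x. x \<in> carrier_vec n \<Longrightarrow> (B *\<^sub>v x) \<bullet> (B *\<^sub>v x) \<le> K * (x \<bullet> x)"
    using mult_mat_vec_bounded[OF B(1)] by blast
  show thesis
  proof
    show "0 < 1 / (K * C)" using K \<open>0 < C\<close> by simp
    fix x :: "real vec" assume x: "x \<in> carrier_vec n"
    have Lx: "L *\<^sub>v x \<in> carrier_vec n" using L x by simp
    have "B *\<^sub>v (L *\<^sub>v x) = x"
      using assoc_mult_mat_vec[OF B(1) L x] B(2) x by simp
    then have "x \<bullet> x \<le> K * ((L *\<^sub>v x) \<bullet> (L *\<^sub>v x))" using K(2)[OF Lx] by simp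
    also have "\<dots> \<le> K * (C * (x \<bullet> (L *\<^sub>v x)))"
      using psd_form_controls_image[OF L sym psd \<open>0 < C\<close> bound x] K by simp
    finally show "1 / (K * C) * (x \<bullet> x) \<le> x \<bullet> (L *\<^sub>v x)"
      using K \<open>0 < C\<close> by (simp add: field_simps)
  qed
qed

lemma transpose_shifted:
  assumes N: "N \<in> carrier_mat n n" and sym: "N\<^sup>T = N"
  shows "(c \<cdot>\<^sub>m 1\<^sub>m n - N)\<^sup>T = c \<cdot>\<^sub>m 1\<^sub>m n - N"
proof (rule eq_matI)
  fix i j assume "i < dim_row (c \<cdot>\<^sub>m 1\<^sub>m n - N)" "j < dim_col (c \<cdot>\<^sub>m 1\<^sub>m n - N)"
  then show "(c \<cdot>\<^sub>m 1\<^sub>m n - N)\<^sup>T $$ (i, j) = (c \<cdot>\<^sub>m 1\<^sub>m n - N) $$ (i, j)"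
    using N arg_cong[OF sym, of "\<lambda>A. A $$ (i, j)"] by auto
qed (use N in auto)

lemma shifted_form:
  fixes N :: "'a::comm_ring_1 mat"
  assumes N: "N \<in> carrier_mat n n" and x: "x \<in> carrier_vec n"
  shows "(c \<cdot>\<^sub>m 1\<^sub>m n - N) *\<^sub>v x = 0\<^sub>v n \<longleftrightarrow> N *\<^sub>v x = c \<cdot>\<^sub>v x"
    and "x \<bullet> ((c \<cdot>\<^sub>m 1\<^sub>m n - N) *\<^sub>v x) = c * (x \<bullet> x) - x \<bullet> (N *\<^sub>v x)"
proof -
  have "(c \<cdot>\<^sub>m 1\<^sub>m n) *\<^sub>v x = c \<cdot>\<^sub>v x"
    by (rule eq_vecI) (use x in auto)
  then have *: "(c \<cdot>\<^sub>m 1\<^sub>m n - N) *\<^sub>v x = c \<cdot>\<^sub>v x - N *\<^sub>v x"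
    using minus_mult_distrib_mat_vec[of "c \<cdot>\<^sub>m 1\<^sub>m n" n n N x] N x by simp
  show "(c \<cdot>\<^sub>m 1\<^sub>m n - N) *\<^sub>v x = 0\<^sub>v n \<longleftrightarrow> N *\<^sub>v x = c \<cdot>\<^sub>v x"
    unfolding * vec_eq_iff using N x by auto
  show "x \<bullet> ((c \<cdot>\<^sub>m 1\<^sub>m n - N) *\<^sub>v x) = c * (x \<bullet> x) - x \<bullet> (N *\<^sub>v x)"
    unfolding * using N x by (subst scalar_prod_minus_distrib[of _ n]) auto
qed

lemma rayleigh_le:
  fixes N :: "real mat"
  assumes N: "N \<in> carrier_mat n n" and sym: "N\<^sup>T = N"
    and ev: "\<And>k. eigenvalue N k \<Longrightarrow> k \<le> c"
    and x: "x \<in> carrier_vec n"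
  shows "x \<bullet> (N *\<^sub>v x) \<le> c * (x \<bullet> x)"
proof -
  obtain K where K: "0 < K" "\<And>x. x \<in> carrier_vec n \<Longrightarrow> (N *\<^sub>v x) \<bullet> (N *\<^sub>v x) \<le> K * (x \<bullet> x)"
    using mult_mat_vec_bounded[OF N] by blast
  have abs: "\<bar>y \<bullet> (N *\<^sub>v y)\<bar> \<le> (1 + K) * (y \<bullet> y)" if y: "y \<in> carrier_vec n" for y
  proof -
    have z: "N *\<^sub>v y \<in> carrier_vec n" using N y by simp
    \<comment> \<open>Expanding both squares bounds the form from below and from above.\<close>
    have "0 \<le> (y + N *\<^sub>v y) \<bullet> (y + N *\<^sub>v y)" "0 \<le> (y - N *\<^sub>v y) \<bullet> (y - N *\<^sub>v y)"
      by (rule scalar_prod_self_nonneg)+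
    then have "2 * \<bar>y \<bullet> (N *\<^sub>v y)\<bar> \<le> y \<bullet> y + (N *\<^sub>v y) \<bullet> (N *\<^sub>v y)"
      using y z comm_scalar_prod[OF z y]
      by (simp add: add_scalar_prod_distrib[of _ n] scalar_prod_add_distrib[of _ n]
          minus_scalar_prod_distrib[of _ n] scalar_prod_minus_distrib[of _ n])
    then show ?thesis
      using K(2)[OF y] scalar_prod_self_nonneg[of y] K(1) mult_nonneg_nonneg[of K "y \<bullet> y"]
      by (simp add: algebra_simps)
  qed
  \<comment> \<open>The admissible constants. The constraint \<open>c \<le> d\<close> bounds the set
    from below and places its infimum \<mu> at or above \<open>c\<close>, so only
    \<open>c < \<mu>\<close> has to be refuted.\<close>
  define S where "S = {d. c \<le> d \<and> (\<forall>x\<in>carrier_vec n. x \<bullet> (N *\<^sub>v x) \<le> d * (x \<bullet> x))}"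
  define \<mu> where "\<mu> = Inf S"
  have "max c (1 + K) \<in> S"
  proof -
    have "y \<bullet> (N *\<^sub>v y) \<le> max c (1 + K) * (y \<bullet> y)" if "y \<in> carrier_vec n" for y
      using abs[OF that] mult_right_mono[OF max.cobounded2[of "1 + K" c] scalar_prod_self_nonneg[of y]]
      by linarith
    then show ?thesis by (simp add: S_def)
  qed
  then have ne: "S \<noteq> {}" by auto
  have below: "bdd_below S" unfolding S_def by (intro bdd_belowI[of _ c]) auto
  have c\<mu>: "c \<le> \<mu>" unfolding \<mu>_def by (rule cInf_greatest[OF ne]) (auto simp: S_def)
  have \<mu>: "y \<bullet> (N *\<^sub>v y) \<le> \<mu> * (y \<bullet> y)" if y: "y \<in> carrier_vec n" for y
  proof (cases "y \<bullet> y = 0")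
    case True
    then show ?thesis using abs[OF y] by simp
  next
    case False
    then have pos: "0 < y \<bullet> y" using scalar_prod_self_nonneg[of y] by simp
    have "(y \<bullet> (N *\<^sub>v y)) / (y \<bullet> y) \<le> \<mu>" unfolding \<mu>_def
      by (rule cInf_greatest[OF ne]) (use y pos in \<open>auto simp: S_def field_simps\<close>)
    then show ?thesis using pos by (simp add: field_simps)
  qed
  \<comment> \<open>If the optimal bound \<open>\<mu>\<close> were no eigenvalue, then \<open>\<mu> I - N\<close> would be coercive and
    \<open>\<mu>\<close> could be lowered.\<close>
  have "\<mu> = c"
  proof (rule ccontr)
    assume "\<mu> \<noteq> c"
    with c\<mu> have "c < \<mu>" by simp
    define L where "L = \<mu> \<cdot>\<^sub>m 1\<^sub>m n - N"
    have L: "L \<in> carrier_mat n n" using N unfolding L_def by (intro minus_carrier_mat) auto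
    note symL = transpose_shifted[OF N sym, of \<mu>, folded L_def]
    note form = shifted_form[OF N, where c = \<mu>, folded L_def]
    have psd: "0 \<le> y \<bullet> (L *\<^sub>v y)" if "y \<in> carrier_vec n" for y
      using \<mu>[OF that] form(2)[OF that] by simp
    have bound: "y \<bullet> (L *\<^sub>v y) \<le> (\<bar>\<mu>\<bar> + 1 + K) * (y \<bullet> y)" if "y \<in> carrier_vec n" for y
      using abs[OF that] form(2)[OF that]
        mult_right_mono[OF abs_ge_self[of \<mu>] scalar_prod_self_nonneg[of y]]
      by (simp add: algebra_simps)
    have "det L \<noteq> 0"
    proof
      assume "det L = 0"
      then obtain v where v: "v \<in> carrier_vec n" "v \<noteq> 0\<^sub>v n" "L *\<^sub>v v = 0\<^sub>v n"
        unfolding det_0_iff_vec_prod_zero_field[OF L] by blast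
      then have "eigenvalue N \<mu>"
        using form(1)[OF v(1)] N unfolding eigenvalue_def eigenvector_def by auto
      then show False using ev \<open>c < \<mu>\<close> by force
    qed
    then obtain \<epsilon> where \<epsilon>: "0 < \<epsilon>" "\<And>y. y \<in> carrier_vec n \<Longrightarrow> \<epsilon> * (y \<bullet> y) \<le> y \<bullet> (L *\<^sub>v y)"
      using psd_nonsingular_coercive[OF L symL psd _ bound] K by (smt (verit) abs_ge_zero)
    \<comment> \<open>The maximum with \<open>c\<close> keeps the lowered constant inside
      \<open>S\<close>; it is still below \<mu>.\<close>
    have "y \<bullet> (N *\<^sub>v y) \<le> max c (\<mu> - \<epsilon>) * (y \<bullet> y)" if "y \<in> carrier_vec n" for y
      using \<epsilon>(2)[OF that] form(2)[OF that]
        mult_right_mono[OF max.cobounded2[of "\<mu> - \<epsilon>" c] scalar_prod_self_nonneg[of y]]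
      by (simp add: algebra_simps)
    then have "max c (\<mu> - \<epsilon>) \<in> S" by (simp add: S_def)
    then have "\<mu> \<le> max c (\<mu> - \<epsilon>)" unfolding \<mu>_def by (rule cInf_lower[OF _ below])
    then show False using \<open>c < \<mu>\<close> \<epsilon>(1) by auto
  qed
  then show ?thesis using \<mu>[OF x] by simp
qed

text \<open>The matrix \<open>c I - N\<close> is positive semidefinite and its form vanishes at
  \<open>x\<close>, so by \<open>psd_form_controls_image\<close> it annihilates
  \<open>x\<close>.\<close>

lemma rayleigh_eq_imp_eigen:
  fixes N :: "real mat"
  assumes N: "N \<in> carrier_mat n n" and sym: "N\<^sup>T = N"
    and psd: "\<And>x. x \<in> carrier_vec n \<Longrightarrow> 0 \<le> x \<bullet> (N *\<^sub>v x)"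
    and ub: "\<And>x. x \<in> carrier_vec n \<Longrightarrow> x \<bullet> (N *\<^sub>v x) \<le> c * (x \<bullet> x)"
    and x: "x \<in> carrier_vec n" and eq: "x \<bullet> (N *\<^sub>v x) = c * (x \<bullet> x)"
  shows "N *\<^sub>v x = c \<cdot>\<^sub>v x"
proof -
  define L where "L = c \<cdot>\<^sub>m 1\<^sub>m n - N"
  have L: "L \<in> carrier_mat n n" using N unfolding L_def by (intro minus_carrier_mat) auto
  note symL = transpose_shifted[OF N sym, of c, folded L_def]
  note form = shifted_form[OF N, where c = c, folded L_def]
  \<comment> \<open>Positivity of \<open>N\<close> bounds the form of \<open>L\<close> by
    \<open>c\<close> times the squared norm. Passing to \<open>\<bar>c\<bar> + 1\<close> secures a
    positive constant.\<close>
  have "(L *\<^sub>v x) \<bullet> (L *\<^sub>v x) \<le> (\<bar>c\<bar> + 1) * (x \<bullet> (L *\<^sub>v x))"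
  proof (rule psd_form_controls_image[OF L symL _ _ _ x])
    fix y :: "real vec" assume y: "y \<in> carrier_vec n"
    show "0 \<le> y \<bullet> (L *\<^sub>v y)" using ub[OF y] form(2)[OF y] by simp
    have "(\<bar>c\<bar> + 1) * (y \<bullet> y) - c * (y \<bullet> y) = (\<bar>c\<bar> + 1 - c) * (y \<bullet> y)"
      by (simp add: algebra_simps)
    also have "\<dots> \<ge> 0" using scalar_prod_self_nonneg[of y] by (intro mult_nonneg_nonneg) auto
    finally show "y \<bullet> (L *\<^sub>v y) \<le> (\<bar>c\<bar> + 1) * (y \<bullet> y)"
      using psd[OF y] form(2)[OF y] by linarith
  qed simp
  then have "(L *\<^sub>v x) \<bullet> (L *\<^sub>v x) = 0"
    using form(2)[OF x] eq scalar_prod_self_nonneg[of "L *\<^sub>v x"] by simp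
  then have "L *\<^sub>v x = 0\<^sub>v n"
    using conjugate_square_eq_0_vec[of "L *\<^sub>v x" n] L x by simp
  then show ?thesis using form(1)[OF x] by simp
qed

section \<open>The largest singular value tested on the all-ones vector\<close>

lemma singular_value_top:
  assumes M: "M \<in> carrier_mat n m" and x: "x \<in> set (singular_values M)"
  shows "x \<le> singular_values M ! 0"
proof -
  obtain i where "i < length (singular_values M)" "x = singular_values M ! i"
    using x by (auto simp: in_set_conv_nth)
  then show ?thesis
    using singular_values(2)[OF M] by (cases "i = 0") (auto simp: sorted_wrt_iff_nth_less)
qed

lemma gram_rayleigh_le:
  fixes M :: "real mat"
  assumes M: "M \<in> carrier_mat n m" and x: "x \<in> carrier_vec n"
  shows "x \<bullet> ((M * M\<^sup>T) *\<^sub>v x) \<le> (singular_values M ! 0)^2 * (x \<bullet> x)"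
proof (rule rayleigh_le[OF _ _ _ x])
  show G: "M * M\<^sup>T \<in> carrier_mat n n" and "(M * M\<^sup>T)\<^sup>T = M * M\<^sup>T"
    using M by (auto simp: transpose_mult[of M n m])
  fix k assume "eigenvalue (M * M\<^sup>T) k"
  then obtain y where y: "y \<in> set (singular_values M)" "k = y^2"
    unfolding eigenvalue_root_char_poly[OF G] singular_values(4)[OF M] poly_prod_list
    by (auto simp: prod_list_zero_iff)
  then show "k \<le> (singular_values M ! 0)^2"
    using singular_value_top[OF M y(1)] singular_values(3)[OF M] by (auto intro!: power_mono)
qed

lemma gram_rayleigh_eq_imp_eigen:
  fixes M :: "real mat"
  assumes M: "M \<in> carrier_mat n m" and x: "x \<in> carrier_vec n"
    and eq: "x \<bullet> ((M * M\<^sup>T) *\<^sub>v x) = (singular_values M ! 0)^2 * (x \<bullet> x)"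
  shows "(M * M\<^sup>T) *\<^sub>v x = (singular_values M ! 0)^2 \<cdot>\<^sub>v x"
proof (rule rayleigh_eq_imp_eigen[OF _ _ _ gram_rayleigh_le[OF M] x eq])
  show "M * M\<^sup>T \<in> carrier_mat n n" "(M * M\<^sup>T)\<^sup>T = M * M\<^sup>T"
    using M by (auto simp: transpose_mult[of M n m])
  show "0 \<le> y \<bullet> ((M * M\<^sup>T) *\<^sub>v y)" if "y \<in> carrier_vec n" for y
    using gram_quadratic_form[OF M that that] scalar_prod_self_nonneg by simp
qed

text \<open>At the all-ones vector \<open>u\<close> the Gram form is the sum of the squared column
  sums. These have mean \<open>t\<close>, so the form is at least \<open>n t^2\<close>, while the
  Rayleigh bound caps it by \<open>n\<close> times the square of the top singular value. Equality
  removes the variance of the column sums and makes \<open>u\<close> an eigenvector, which fixes the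
  row sums.\<close>

lemma mean_row_sum_le_top_singular_value:
  fixes M :: "real mat"
  assumes M: "M \<in> carrier_mat n n" and "0 < n" and "0 < t"
    and total: "(\<Sum>i<n. \<Sum>j<n. M $$ (i, j)) = real n * t"
  shows "t \<le> singular_values M ! 0"
    and "singular_values M ! 0 = t \<Longrightarrow> i < n \<Longrightarrow> (\<Sum>j<n. M $$ (i, j)) = t"
    and "singular_values M ! 0 = t \<Longrightarrow> j < n \<Longrightarrow> (\<Sum>i<n. M $$ (i, j)) = t"
proof -
  let ?s = "singular_values M ! 0"
  define u :: "real vec" where "u = vec n (\<lambda>_. 1)"
  define c where "c j = (\<Sum>i<n. M $$ (i, j))" for j
  have u: "u \<in> carrier_vec n" by (simp add: u_def)
  have uu: "u \<bullet> u = real n" by (simp add: u_def scalar_prod_def)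
  have Mu: "(M *\<^sub>v u) $ i = (\<Sum>j<n. M $$ (i, j))" if "i < n" for i
    using that M by (simp add: u_def scalar_prod_def atLeast0LessThan)
  have Mtu: "M\<^sup>T *\<^sub>v u = vec n c"
    using M by (intro eq_vecI) (auto simp: u_def scalar_prod_def atLeast0LessThan c_def)
  have quad: "u \<bullet> ((M * M\<^sup>T) *\<^sub>v u) = (\<Sum>j<n. (c j)^2)"
    unfolding gram_quadratic_form[OF M u u] Mtu
    by (simp add: scalar_prod_def atLeast0LessThan power2_eq_square)
  have sum_c: "(\<Sum>j<n. c j) = real n * t"
    unfolding c_def by (subst sum.swap) (rule total)
  have var: "(\<Sum>j<n. (c j - t)^2) = (\<Sum>j<n. (c j)^2) - real n * t^2"
    by (simp add: power2_diff sum.distrib sum_subtractf sum_distrib_left[symmetric]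
        sum_distrib_right[symmetric] sum_c power2_eq_square algebra_simps)
  have le: "(\<Sum>j<n. (c j)^2) \<le> ?s^2 * real n"
    using gram_rayleigh_le[OF M u] by (simp add: quad uu)
  have "0 \<le> (\<Sum>j<n. (c j - t)^2)" by (intro sum_nonneg) auto
  then have ge: "real n * t^2 \<le> (\<Sum>j<n. (c j)^2)" using var by simp
  with le have "real n * t^2 \<le> real n * ?s^2" by (simp add: mult.commute)
  then have "t^2 \<le> ?s^2" using \<open>0 < n\<close> by simp
  moreover have "0 \<le> ?s"
    using singular_values(1,3)[OF M] \<open>0 < n\<close> by auto
  ultimately show "t \<le> ?s" by (rule power2_le_imp_le)
  assume eq: "?s = t"
  have "(\<Sum>j<n. (c j - t)^2) = 0"
    using var le \<open>0 \<le> (\<Sum>j<n. (c j - t)^2)\<close> by (simp add: eq mult.commute)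
  then have c: "c j = t" if "j < n" for j
    using that by (simp add: sum_nonneg_eq_0_iff)
  then show "j < n \<Longrightarrow> (\<Sum>i<n. M $$ (i, j)) = t" by (simp add: c_def)
  have Mtu': "M\<^sup>T *\<^sub>v u = t \<cdot>\<^sub>v u"
    unfolding Mtu by (rule eq_vecI) (auto simp: u_def c)
  have "u \<bullet> ((M * M\<^sup>T) *\<^sub>v u) = ?s^2 * (u \<bullet> u)"
    using quad le ge by (simp add: uu eq mult.commute)
  \<comment> \<open>Since \<open>u\<close> attains the Rayleigh bound, it is an eigenvector of the
    Gram matrix. As \<open>M\<^sup>T\<close> maps \<open>u\<close> to \<open>t\<close> times
    \<open>u\<close>, one factor \<open>t > 0\<close> cancels and leaves the row sums of
    \<open>M\<close>.\<close>
  then have "(M * M\<^sup>T) *\<^sub>v u = t^2 \<cdot>\<^sub>v u"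
    using gram_rayleigh_eq_imp_eigen[OF M u] eq by simp
  moreover have "(M * M\<^sup>T) *\<^sub>v u = t \<cdot>\<^sub>v (M *\<^sub>v u)"
    using M u Mtu' mult_mat_vec[OF M u, of t] by simp
  ultimately have vec: "t \<cdot>\<^sub>v (M *\<^sub>v u) = t^2 \<cdot>\<^sub>v u" by simp
  show "(\<Sum>j<n. M $$ (i, j)) = t" if i: "i < n"
  proof -
    have "t * (\<Sum>j<n. M $$ (i, j)) = t^2"
      using arg_cong[OF vec, of "\<lambda>v. v $ i"] i M Mu[OF i] by (simp add: u_def del: index_mult_mat_vec)
    then show ?thesis using \<open>0 < t\<close> by (simp add: power2_eq_square)
  qed
qed

section \<open>Unions of directed cycles\<close>

lemma cycle_decomp_permutes: "cycle_decomp I p \<Longrightarrow> p permutes I"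
proof (induction rule: cycle_decomp.induct)
  case (comp I p cs)
  then show ?case
    by (intro permutes_compose permutes_subset[OF cycle_permutes[of cs]] permutes_subset[OF comp(4)]) auto
qed (auto simp: permutes_def)

text \<open>Bridges the indexed arcs of a cycle and the cyclic permutation, whose values along
  \<open>cs\<close> form \<open>rotate1 cs\<close>.\<close>

lemma cycle_arcs_eq_graph:
  assumes "distinct cs"
  shows "cycle_arcs cs = (\<lambda>i. (i, cycle_of_list cs i)) ` set cs"
proof -
  have step: "cycle_of_list cs (cs ! k) = cs ! ((k + 1) mod length cs)" if "k < length cs" for k
  proof -
    have "map (cycle_of_list cs) cs = rotate1 cs"
      using cyclic_rotation[OF assms, of 1] by simp
    then show ?thesis
      using that by (metis Suc_eq_plus1 nth_map nth_rotate1)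
  qed
  show ?thesis
    unfolding cycle_arcs_def set_conv_nth by (auto simp: step)
qed

text \<open>Induction over the decomposition: the new cycle and the old permutation have disjoint
  supports, so the graph of the composite is the union of the two graphs.\<close>

lemma cycle_decomp_arcs:
  assumes "cycle_decomp I p" and "\<forall>i\<in>I. p i \<noteq> i"
  shows "\<exists>C. finite C \<and> (\<forall>ws\<in>C. distinct ws \<and> length ws \<ge> 2) \<and>
    (\<forall>ws\<in>C. \<forall>vs\<in>C. ws \<noteq> vs \<longrightarrow> set ws \<inter> set vs = {}) \<and>
    (\<Union>ws\<in>C. set ws) = I \<and> (\<lambda>i. (i, p i)) ` I = (\<Union>ws\<in>C. cycle_arcs ws)"
  using assms
proof (induction rule: cycle_decomp.induct)
  case empty
  then show ?case by (intro exI[of _ "{}"]) auto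
next
  case (comp I p cs)
  let ?q = "cycle_of_list cs \<circ> p"
  have p: "p permutes I" by (rule cycle_decomp_permutes[OF comp(1)])
  have on_I: "?q i = p i" if "i \<in> I" for i
    using that comp(3) permutes_in_image[OF p, of i] by (auto intro!: id_outside_supp)
  have on_cs: "?q i = cycle_of_list cs i" if "i \<in> set cs" for i
    using that comp(3) permutes_not_in[OF p, of i] by (auto simp: disjoint_iff)
  have "\<forall>i\<in>I. p i \<noteq> i" using comp(5) on_I by (metis UnI2)
  from comp(4)[OF this] obtain C where
    C: "finite C" "\<forall>ws\<in>C. distinct ws \<and> length ws \<ge> 2"
      "\<forall>ws\<in>C. \<forall>vs\<in>C. ws \<noteq> vs \<longrightarrow> set ws \<inter> set vs = {}"
      "(\<Union>ws\<in>C. set ws) = I" "(\<lambda>i. (i, p i)) ` I = (\<Union>ws\<in>C. cycle_arcs ws)"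
    by blast
  have graph: "(\<lambda>i. (i, ?q i)) ` (set cs \<union> I) = cycle_arcs cs \<union> (\<Union>ws\<in>C. cycle_arcs ws)"
    unfolding image_Un C(5)[symmetric] cycle_arcs_eq_graph[OF comp(2)]
    using on_I on_cs by (intro arg_cong2[of _ _ _ _ "(\<union>)"] image_cong) auto
  show ?case
  \<comment> \<open>A decomposition may contain the empty list, which adds no arc. A list with one
    entry would produce a fixed point, so the remaining cycles have length at least 2.\<close>
  proof (cases "cs = []")
    case True
    then show ?thesis
      using C graph by (intro exI[of _ C]) (simp add: cycle_arcs_def)
  next
    case False
    have "length cs \<noteq> 1"
    proof
      assume "length cs = 1"
      then obtain x where "cs = [x]" by (auto simp: length_Suc_conv)
      then show False using on_cs[of x] comp(5) by auto
    qed
    then have "length cs \<ge> 2" using False by (cases cs rule: remdups_adj.cases) auto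
    then show ?thesis
      unfolding graph using C comp(2,3) by (intro exI[of _ "insert cs C"]) auto
  qed
qed

lemma outdeg_one_iff: "outdeg Arcs i = 1 \<longleftrightarrow> (\<exists>!j. (i, j) \<in> Arcs)"
  unfolding outdeg_def One_nat_def card_1_singleton_iff by (auto simp: set_eq_iff)

lemma indeg_one_iff: "indeg Arcs i = 1 \<longleftrightarrow> (\<exists>!j. (j, i) \<in> Arcs)"
  unfolding indeg_def One_nat_def card_1_singleton_iff by (auto simp: set_eq_iff)

text \<open>Outdegree 1 makes the arcs the graph of a map, indegree 1 makes the map injective, and
  the absence of loops makes the resulting permutation free of fixed points on the vertices.\<close>

lemma one_regular_imp_direct_sum_of_cycles:
  assumes "digraph n Arcs" and reg: "regular n Arcs 1"
  shows "direct_sum_of_cycles n Arcs"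
proof -
  have sub: "Arcs \<subseteq> {0..<n} \<times> {0..<n}" and irrefl: "\<And>i. (i, i) \<notin> Arcs"
    using assms(1) by (auto simp: digraph_def)
  have out: "\<exists>!j. (i, j) \<in> Arcs" and ind: "\<exists>!j. (j, i) \<in> Arcs" if "i < n" for i
    using reg that outdeg_one_iff[of Arcs i] indeg_one_iff[of Arcs i] by (auto simp: regular_def)
  \<comment> \<open>The identity outside the vertex set is what \<open>permutes\<close>
    demands.\<close>
  define p where "p i = (if i < n then THE j. (i, j) \<in> Arcs else i)" for i
  have p: "(i, p i) \<in> Arcs" if "i < n" for i
    using theI'[OF out[OF that]] that by (simp add: p_def)
  have p_lt: "p i < n" if "i < n" for i using p[OF that] sub by auto
  have "inj_on p {0..<n}"
  proof (rule inj_onI)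
    fix i j assume ij: "i \<in> {0..<n}" "j \<in> {0..<n}" "p i = p j"
    then have "(i, p i) \<in> Arcs" "(j, p i) \<in> Arcs" using p[of i] p[of j] by simp_all
    then show "i = j" using ind[OF p_lt[of i]] ij by auto
  qed
  then have "p permutes {0..<n}"
    using p_lt by (intro inj_on_nat_permutes) (auto simp: p_def)
  then have "cycle_decomp {0..<n} p" by (rule cycle_decomposition) simp
  moreover have "\<forall>i\<in>{0..<n}. p i \<noteq> i" using p irrefl by (metis atLeastLessThan_iff)
  moreover have "Arcs = (\<lambda>i. (i, p i)) ` {0..<n}"
  proof
    show "Arcs \<subseteq> (\<lambda>i. (i, p i)) ` {0..<n}"
    proof
      fix e assume e: "e \<in> Arcs"
      then obtain i j where ij: "e = (i, j)" "i < n" using sub by auto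
      then have "j = p i" using out[of i] p[of i] e by auto
      then show "e \<in> (\<lambda>i. (i, p i)) ` {0..<n}" using ij by auto
    qed
  qed (use p in auto)
  ultimately show ?thesis
    unfolding direct_sum_of_cycles_def using cycle_decomp_arcs[of "{0..<n}" p] by simp
qed

text \<open>Disjointness places a vertex on one cycle only, and distinctness at one position of it.
  The second claim is phrased for tails of arcs because it is used to show that different rows of
  the adjacency matrix have disjoint supports.\<close>

lemma direct_sum_of_cycles_degrees:
  assumes "direct_sum_of_cycles n Arcs"
  shows "\<And>i. i < n \<Longrightarrow> outdeg Arcs i = 1"
    and "\<And>i i' j. (i, j) \<in> Arcs \<Longrightarrow> (i', j) \<in> Arcs \<Longrightarrow> i = i'"
proof -
  obtain C where C: "\<forall>ws\<in>C. distinct ws \<and> length ws \<ge> 2"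
      "\<forall>ws\<in>C. \<forall>vs\<in>C. ws \<noteq> vs \<longrightarrow> set ws \<inter> set vs = {}"
      "(\<Union>ws\<in>C. set ws) = {0..<n}" and Arcs: "Arcs = (\<Union>ws\<in>C. cycle_arcs ws)"
    using assms unfolding direct_sum_of_cycles_def by blast
  define h where "h ws k = ws ! ((k + 1) mod length ws)" for ws :: "nat list" and k
  have h: "h ws k \<in> set ws" if "ws \<in> C" for ws k
    using C(1) that by (auto simp: h_def intro!: nth_mem mod_less_divisor)
  have arc: "(i, j) \<in> Arcs \<longleftrightarrow> (\<exists>ws\<in>C. \<exists>k<length ws. i = ws ! k \<and> j = h ws k)" for i j
    unfolding Arcs cycle_arcs_def h_def by auto
  have same: "ws = vs" if "ws \<in> C" "vs \<in> C" "x \<in> set ws" "x \<in> set vs" for ws vs x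
    using C(2) that by blast
  show "outdeg Arcs i = 1" if i: "i < n" for i
    unfolding outdeg_one_iff
  proof (rule ex_ex1I)
    obtain ws where "ws \<in> C" "i \<in> set ws" using i C(3) by (metis UN_E atLeastLessThan_iff zero_le)
    then show "\<exists>j. (i, j) \<in> Arcs" unfolding arc in_set_conv_nth by blast
    fix j j' assume "(i, j) \<in> Arcs" "(i, j') \<in> Arcs"
    then obtain ws k vs l where ws: "ws \<in> C" "k < length ws" "i = ws ! k" "j = h ws k"
      and vs: "vs \<in> C" "l < length vs" "i = vs ! l" "j' = h vs l"
      unfolding arc by blast
    have "ws = vs" using same[OF ws(1) vs(1), of i] ws vs nth_mem by metis
    moreover from this have "k = l" using C(1) ws vs nth_eq_iff_index_eq by metis
    ultimately show "j = j'" using ws vs by simp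
  qed
  show "i = i'" if arcs: "(i, j) \<in> Arcs" "(i', j) \<in> Arcs" for i i' j
  proof -
    obtain ws k vs l where ws: "ws \<in> C" "k < length ws" "i = ws ! k" "j = h ws k"
      and vs: "vs \<in> C" "l < length vs" "i' = vs ! l" "j = h vs l"
      using arcs unfolding arc by blast
    have eq: "ws = vs" using same[OF ws(1) vs(1), of j] ws vs h by metis
    \<comment> \<open>Equal heads occupy equal positions, and the cyclic successor is injective on
      the indices below the length.\<close>
    have "(k + 1) mod length ws < length ws" "(l + 1) mod length ws < length ws"
      using ws by (auto intro!: mod_less_divisor)
    then have "(k + 1) mod length ws = (l + 1) mod length ws"
      using ws vs C(1) nth_eq_iff_index_eq unfolding eq h_def by metis
    then have "k = l" using ws(2) vs(2) eq by (auto simp: mod_Suc split: if_splits)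
    then show ?thesis using ws vs eq by simp
  qed
qed

section \<open>The bound and its equality case\<close>

text \<open>Assuming only that the sum reaches the extremal value lets one lemma deliver both the
  inequality and the description of equality. The quantity estimated is the squared distance of
  \<open>s\<close> from the list with head \<open>t\<close> and all other entries \<sigma>.\<close>

lemma extremal_list:
  fixes s :: "real list"
  assumes len: "length s = n" "2 \<le> n" and "t \<le> s ! 0" "\<sigma> \<le> t" "0 \<le> \<sigma>"
    and squares: "(\<Sum>x\<leftarrow>s. x^2) = t^2 + (real n - 1) * \<sigma>^2"
    and large: "t + (real n - 1) * \<sigma> \<le> sum_list s"
  shows "s ! 0 = t \<and> (\<forall>i\<in>{1..<n}. s ! i = \<sigma>)"
proof -
  have split: "sum_list (map f s) = f (s ! 0) + (\<Sum>i\<in>{1..<n}. f (s ! i))" for f :: "real \<Rightarrow> real"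
  proof -
    have "sum_list (map f s) = (\<Sum>i\<in>{0..<n}. f (s ! i))"
      using len by (simp add: sum_list_sum_nth)
    then show ?thesis using len by (simp add: sum.atLeast_Suc_lessThan)
  qed
  define S where "S = (\<Sum>i\<in>{1..<n}. s ! i)"
  define Q where "Q = (\<Sum>i\<in>{1..<n}. (s ! i)^2)"
  define V where "V = (\<Sum>i\<in>{1..<n}. (s ! i - \<sigma>)^2)"
  have S: "t + (real n - 1) * \<sigma> \<le> s ! 0 + S" and Q: "(s ! 0)^2 + Q = t^2 + (real n - 1) * \<sigma>^2"
    using large squares split[of "\<lambda>x. x"] split[of "\<lambda>x. x^2"] by (simp_all add: S_def Q_def)
  have V: "V = Q - 2 * \<sigma> * S + (real n - 1) * \<sigma>^2"
    using len
    by (simp add: V_def Q_def S_def power2_diff sum.distrib sum_subtractf sum_distrib_left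
        algebra_simps of_nat_diff)
  \<comment> \<open>The lower bound on the sum enters with weight \<sigma>, matching the cross term
    of \<open>V\<close>; the fixed sum of squares then leaves only the product of
    \<open>t - \<sigma>\<close> and \<open>t - s ! 0\<close>.\<close>
  have "\<sigma> * (t + (real n - 1) * \<sigma>) \<le> \<sigma> * (s ! 0 + S)"
    using S \<open>0 \<le> \<sigma>\<close> by (rule mult_left_mono)
  then have "V + (s ! 0 - t)^2 \<le> 2 * ((t - \<sigma>) * (t - s ! 0))"
    using V Q by (simp add: power2_eq_square algebra_simps)
  moreover have "(t - \<sigma>) * (t - s ! 0) \<le> 0"
    using assms by (intro mult_nonneg_nonpos) auto
  moreover have "0 \<le> V" unfolding V_def by (intro sum_nonneg) auto
  ultimately have "(s ! 0 - t)^2 \<le> 0" "V \<le> 0"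
    using zero_le_power2[of "s ! 0 - t"] by linarith+
  then have "s ! 0 = t" "V = 0" using \<open>0 \<le> V\<close> by simp_all
  then show ?thesis unfolding V_def by (simp add: sum_nonneg_eq_0_iff)
qed

section \<open>Entries, row and column sums, and Frobenius norm of \<open>A_alpha\<close>\<close>

lemma A_alpha_carrier: "A_alpha \<alpha> n Arcs \<in> carrier_mat n n"
  by (auto simp: A_alpha_def outdeg_mat_def adj_mat_def)

lemma A_alpha_entry:
  assumes "i < n" "j < n"
  shows "A_alpha \<alpha> n Arcs $$ (i, j) =
    \<alpha> * (if i = j then real (outdeg Arcs i) else 0) + (1 - \<alpha>) * of_bool ((i, j) \<in> Arcs)"
  using assms by (simp add: A_alpha_def outdeg_mat_def adj_mat_def)

lemma degree_sums:
  assumes "digraph n Arcs"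
  shows "(\<Sum>j<n. of_bool ((i, j) \<in> Arcs)) = real (outdeg Arcs i)"
    and "(\<Sum>j<n. of_bool ((j, i) \<in> Arcs)) = real (indeg Arcs i)"
    and "(\<Sum>i<n. real (outdeg Arcs i)) = real (card Arcs)"
proof -
  have sub: "Arcs \<subseteq> {..<n} \<times> {..<n}"
    using assms by (auto simp: digraph_def)
  then have "{..<n} \<inter> {j. (i, j) \<in> Arcs} = {j. (i, j) \<in> Arcs}"
    "{..<n} \<inter> {j. (j, i) \<in> Arcs} = {j. (j, i) \<in> Arcs}" for i by auto
  then show "(\<Sum>j<n. of_bool ((i, j) \<in> Arcs)) = real (outdeg Arcs i)"
    and "(\<Sum>j<n. of_bool ((j, i) \<in> Arcs)) = real (indeg Arcs i)" for i
    by (simp_all add: outdeg_def indeg_def)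
  \<comment> \<open>Arcs are counted by their tails.\<close>
  have "Arcs = (SIGMA i:{..<n}. {j. (i, j) \<in> Arcs})" using sub by auto
  then have "card Arcs = card (SIGMA i:{..<n}. {j. (i, j) \<in> Arcs})" by (rule arg_cong)
  also have "finite {j. (i, j) \<in> Arcs}" for i
    by (rule finite_subset[of _ "{..<n}"]) (use sub in auto)
  then have "card (SIGMA i:{..<n}. {j. (i, j) \<in> Arcs}) = (\<Sum>i<n. outdeg Arcs i)"
    unfolding outdeg_def by (intro card_SigmaI) auto
  finally show "(\<Sum>i<n. real (outdeg Arcs i)) = real (card Arcs)" by simp
qed

lemma A_alpha_row_sum:
  assumes "digraph n Arcs" "i < n"
  shows "(\<Sum>j<n. A_alpha \<alpha> n Arcs $$ (i, j)) = real (outdeg Arcs i)"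
proof -
  have "(\<Sum>j<n. A_alpha \<alpha> n Arcs $$ (i, j)) =
      \<alpha> * (\<Sum>j<n. if i = j then real (outdeg Arcs i) else 0)
      + (1 - \<alpha>) * (\<Sum>j<n. of_bool ((i, j) \<in> Arcs))"
    using assms(2) by (simp add: A_alpha_entry sum.distrib sum_distrib_left del: sum.delta sum.delta' sum_of_bool_eq)
  then show ?thesis
    unfolding degree_sums[OF assms(1)] using assms(2) by (simp add: algebra_simps)
qed

lemma A_alpha_col_sum:
  assumes "digraph n Arcs" "j < n"
  shows "(\<Sum>i<n. A_alpha \<alpha> n Arcs $$ (i, j)) =
    \<alpha> * real (outdeg Arcs j) + (1 - \<alpha>) * real (indeg Arcs j)"
proof -
  have "(\<Sum>i<n. A_alpha \<alpha> n Arcs $$ (i, j)) =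
      \<alpha> * (\<Sum>i<n. if i = j then real (outdeg Arcs i) else 0)
      + (1 - \<alpha>) * (\<Sum>i<n. of_bool ((i, j) \<in> Arcs))"
    using assms(2) by (simp add: A_alpha_entry sum.distrib sum_distrib_left del: sum.delta sum.delta' sum_of_bool_eq)
  then show ?thesis
    unfolding degree_sums[OF assms(1)] using assms(2) by simp
qed

lemma A_alpha_frobenius:
  assumes "digraph n Arcs"
  shows "(\<Sum>i<n. \<Sum>j<n. (A_alpha \<alpha> n Arcs $$ (i, j))^2) =
    \<alpha>^2 * (\<Sum>i<n. real (outdeg Arcs i)^2) + (1 - \<alpha>)^2 * real (card Arcs)"
proof -
  \<comment> \<open>Without loops the degree part and the adjacency part never meet in one entry, so
    squaring gives no cross term.\<close>
  have "(A_alpha \<alpha> n Arcs $$ (i, j))^2 =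
      \<alpha>^2 * (if i = j then real (outdeg Arcs i)^2 else 0) + (1 - \<alpha>)^2 * of_bool ((i, j) \<in> Arcs)"
    if "i < n" "j < n" for i j
    using assms that by (auto simp: A_alpha_entry digraph_def power_mult_distrib)
  then have "(\<Sum>i<n. \<Sum>j<n. (A_alpha \<alpha> n Arcs $$ (i, j))^2) =
      (\<Sum>i<n. \<alpha>^2 * (\<Sum>j<n. if i = j then real (outdeg Arcs i)^2 else 0)
        + (1 - \<alpha>)^2 * (\<Sum>j<n. of_bool ((i, j) \<in> Arcs)))"
    by (simp add: sum.distrib sum_distrib_left del: sum.delta sum.delta' sum_of_bool_eq)
  then show ?thesis
    unfolding degree_sums[OF assms]
    by (simp add: sum.distrib sum_distrib_left[symmetric] degree_sums(3)[OF assms])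
qed

lemma A_alpha_frobenius_le:
  assumes "0 \<le> \<alpha>" "\<alpha> < 1" "digraph n Arcs" "0 < n"
  shows "(\<Sum>i<n. \<Sum>j<n. (A_alpha \<alpha> n Arcs $$ (i, j))^2) \<le>
    max (1 - \<alpha>) (\<alpha> * real (max_outdeg n Arcs)) * real (card Arcs)"
proof -
  let ?\<beta> = "max (1 - \<alpha>) (\<alpha> * real (max_outdeg n Arcs))"
  let ?A = "A_alpha \<alpha> n Arcs"
  have "(?A $$ (i, j))^2 \<le> ?\<beta> * ?A $$ (i, j)" if ij: "i < n" "j < n" for i j
  proof -
    have "outdeg Arcs i \<le> max_outdeg n Arcs"
      using ij unfolding max_outdeg_def by (intro Max_ge) auto
    then have "\<alpha> * real (outdeg Arcs i) \<le> \<alpha> * real (max_outdeg n Arcs)"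
      using assms by (intro mult_left_mono) auto
    \<comment> \<open>A diagonal entry is \<alpha> times an outdegree, an off-diagonal one is 0 or
      \<open>1 - \<alpha>\<close>; each is covered by one argument of the maximum.\<close>
    then have "0 \<le> ?A $$ (i, j)" "?A $$ (i, j) \<le> ?\<beta>"
      using assms ij by (auto simp: A_alpha_entry digraph_def)
    then show ?thesis by (simp add: power2_eq_square mult_right_mono)
  qed
  then have "(\<Sum>i<n. \<Sum>j<n. (?A $$ (i, j))^2) \<le> (\<Sum>i<n. \<Sum>j<n. ?\<beta> * ?A $$ (i, j))"
    by (intro sum_mono) auto
  also have "\<dots> = ?\<beta> * (\<Sum>i<n. \<Sum>j<n. ?A $$ (i, j))"
    by (simp add: sum_distrib_left)
  also have "\<dots> = ?\<beta> * real (card Arcs)"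
    using A_alpha_row_sum[OF assms(3)] degree_sums(3)[OF assms(3)] by simp
  finally show ?thesis .
qed

text \<open>For \<alpha> = 0 the matrix is the permutation matrix of the cycles, so its Gram matrix
  is the identity.\<close>

lemma singular_values_direct_sum_of_cycles:
  assumes "digraph n Arcs" and "direct_sum_of_cycles n Arcs"
  shows "singular_values (A_alpha 0 n Arcs) = replicate n 1"
proof (rule singular_values_eqI[OF A_alpha_carrier])
  let ?A = "A_alpha 0 n Arcs"
  note A = A_alpha_carrier[of 0 n Arcs]
  note deg = direct_sum_of_cycles_degrees[OF assms(2)]
  have "?A * ?A\<^sup>T = 1\<^sub>m n"
  proof (rule eq_matI)
    fix i k assume "i < dim_row (1\<^sub>m n :: real mat)" "k < dim_col (1\<^sub>m n :: real mat)"
    then have ik: "i < n" "k < n" by auto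
    have "(?A * ?A\<^sup>T) $$ (i, k) = (\<Sum>j<n. ?A $$ (i, j) * ?A $$ (k, j))"
      using A ik by (simp add: scalar_prod_def atLeast0LessThan)
    \<comment> \<open>Two arcs into the same \<open>j\<close> share their tail, so the products
      vanish for different rows; in one row the entries are 0 or 1 and equal their squares.\<close>
    also have "\<dots> = (\<Sum>j<n. of_bool (i = k) * of_bool ((i, j) \<in> Arcs))"
      using ik deg(2) by (intro sum.cong) (auto simp: A_alpha_entry)
    also have "\<dots> = of_bool (i = k) * (\<Sum>j<n. of_bool ((i, j) \<in> Arcs))"
      by (simp only: sum_distrib_left)
    also have "\<dots> = 1\<^sub>m n $$ (i, k)"
      unfolding degree_sums[OF assms(1)] using ik deg(1) by simp
    finally show "(?A * ?A\<^sup>T) $$ (i, k) = 1\<^sub>m n $$ (i, k)" .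
  qed (use A in auto)
  moreover have "diag_mat (1\<^sub>m n :: real mat) = replicate n 1"
    by (rule nth_equalityI) (auto simp: diag_mat_def)
  ultimately show "char_poly (?A * ?A\<^sup>T) = (\<Prod>x\<leftarrow>replicate n 1. [:- (x^2), 1:])"
    using char_poly_upper_triangular[of "1\<^sub>m n :: real mat" n] by simp
qed (auto simp: sorted_wrt_iff_nth_less)

theorem theorem3p3:
  fixes \<alpha> :: real and n :: nat and Arcs :: "(nat \<times> nat) set"
  assumes "0 \<le> \<alpha>" and "\<alpha> < 1"
    and "n \<ge> 2"
    and "digraph n Arcs"
    and "real (card Arcs) \<ge> real n * max (1 - \<alpha>) (\<alpha> * real (max_outdeg n Arcs))"
  shows "(nuclear_norm (A_alpha \<alpha> n Arcs)
           \<le> real (card Arcs) / real n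
             + sqrt ((real n - 1) * ((1 - \<alpha>)^2 * real (card Arcs)
                 + \<alpha>^2 * (\<Sum>i<n. real (outdeg Arcs i)^2) - real (card Arcs)^2 / real n^2))) \<and>
         (nuclear_norm (A_alpha \<alpha> n Arcs)
           = real (card Arcs) / real n
             + sqrt ((real n - 1) * ((1 - \<alpha>)^2 * real (card Arcs)
                 + \<alpha>^2 * (\<Sum>i<n. real (outdeg Arcs i)^2) - real (card Arcs)^2 / real n^2))
         \<longleftrightarrow>
         ((\<alpha> = 0 \<and> direct_sum_of_cycles n Arcs) \<or>
          (regular n Arcs (real (card Arcs) / real n) \<and>
           (let \<sigma> = sqrt ((\<alpha>^2 * (\<Sum>i<n. real (outdeg Arcs i)^2) + (1 - \<alpha>)^2 * real (card Arcs)
                         - real (card Arcs)^2 / real n^2) / (real n - 1));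
                s = singular_values (A_alpha \<alpha> n Arcs)
            in s ! 0 = real (card Arcs) / real n \<and> (\<forall>i\<in>{1..<n}. s ! i = \<sigma>) \<and>
               \<sigma> \<noteq> real (card Arcs) / real n))))"
proof -
  define A where "A = A_alpha \<alpha> n Arcs"
  define s where "s = singular_values A"
  define a where "a = real (card Arcs)"
  define t where "t = a / real n"
  define F where "F = \<alpha>^2 * (\<Sum>i<n. real (outdeg Arcs i)^2) + (1 - \<alpha>)^2 * a"
  define \<sigma> where "\<sigma> = sqrt ((F - t^2) / (real n - 1))"
  define bound where "bound = t + (real n - 1) * \<sigma>"
  have n: "0 < n" "1 < real n" using assms(3) by auto
  have A: "A \<in> carrier_mat n n" unfolding A_def by (rule A_alpha_carrier)
  have len: "length s = n" using singular_values(1)[OF A] by (simp add: s_def)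
  \<comment> \<open>As \<open>1 - \<alpha> > 0\<close>, the lower bound on the number of arcs
    excludes the empty digraph; this gives \<open>t > 0\<close>.\<close>
  have "0 < real n * max (1 - \<alpha>) (\<alpha> * real (max_outdeg n Arcs))"
    using n assms(2) by (intro mult_pos_pos) auto
  then have "0 < a" using assms(5) by (simp add: a_def)
  then have t: "0 < t" "a = real n * t" using n by (auto simp: t_def)
  have frob: "(\<Sum>i<n. \<Sum>j<n. (A $$ (i, j))^2) = F"
    unfolding A_def F_def a_def by (rule A_alpha_frobenius[OF assms(4)])
  have squares: "(\<Sum>x\<leftarrow>s. x^2) = F"
    unfolding s_def frob[symmetric] by (rule sum_singular_values_squares[OF A])
  have rows: "(\<Sum>j<n. A $$ (i, j)) = real (outdeg Arcs i)" if "i < n" for i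
    unfolding A_def by (rule A_alpha_row_sum[OF assms(4) that])
  have total: "(\<Sum>i<n. \<Sum>j<n. A $$ (i, j)) = real n * t"
    using rows degree_sums(3)[OF assms(4)] t(2) by (simp add: a_def)
  note mean = mean_row_sum_le_top_singular_value[OF A n(1) t(1) total, folded s_def]
  have "t^2 \<le> (s ! 0)^2" using mean(1) t by (intro power_mono) auto
  also have "\<dots> \<le> F"
    unfolding squares[symmetric] using len n
    by (intro member_le_sum_list) auto
  finally have "t^2 \<le> F" .
  have "F \<le> max (1 - \<alpha>) (\<alpha> * real (max_outdeg n Arcs)) * a"
    using A_alpha_frobenius_le[OF assms(1,2,4) n(1)] frob by (simp add: A_def a_def)
  \<comment> \<open>The hypothesis on the number of arcs says exactly that the maximum is at most
    \<open>t\<close>.\<close>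
  also have "\<dots> \<le> t * a"
    using assms(5) n \<open>0 < a\<close>
    by (intro mult_right_mono) (simp_all add: t_def a_def pos_le_divide_eq mult.commute del: max.bounded_iff)
  also have "\<dots> = real n * t^2" using t(2) by (simp add: power2_eq_square)
  finally have F_le: "F \<le> real n * t^2" .
  have \<sigma>0: "0 \<le> \<sigma>" and \<sigma>2: "(real n - 1) * \<sigma>^2 = F - t^2"
    using \<open>t^2 \<le> F\<close> n by (simp_all add: \<sigma>_def)
  have "(real n - 1) * \<sigma>^2 \<le> (real n - 1) * t^2"
    unfolding \<sigma>2 using F_le by (simp add: algebra_simps)
  then have "\<sigma>^2 \<le> t^2" using n by simp
  then have \<sigma>t: "\<sigma> \<le> t" using t by (auto intro: power2_le_imp_le)
  have norm: "nuclear_norm A = sum_list s" by (simp add: nuclear_norm_def s_def)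
  have extremal: "s ! 0 = t \<and> (\<forall>i\<in>{1..<n}. s ! i = \<sigma>)" if "bound \<le> nuclear_norm A"
    by (rule extremal_list[OF len assms(3) mean(1) \<sigma>t \<sigma>0])
      (use that squares \<sigma>2 in \<open>auto simp: norm bound_def\<close>)
  have attained: "nuclear_norm A = bound" if "s ! 0 = t" "\<forall>i\<in>{1..<n}. s ! i = \<sigma>"
  proof -
    have "sum_list s = (\<Sum>i\<in>{0..<n}. s ! i)" using len by (simp add: sum_list_sum_nth)
    also have "\<dots> = s ! 0 + (\<Sum>i\<in>{1..<n}. s ! i)" using n by (simp add: sum.atLeast_Suc_lessThan)
    also have "\<dots> = bound" using that n by (simp add: bound_def of_nat_diff)
    finally show ?thesis by (simp add: norm)
  qed
  \<comment> \<open>Translates the square root of the stated bound into the form used in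
    \<open>bound\<close>.\<close>
  have radicand: "sqrt ((real n - 1) * (F - t^2)) = (real n - 1) * \<sigma>"
  proof -
    have "(real n - 1) * (F - t^2) = ((real n - 1) * \<sigma>)^2"
      by (simp only: \<sigma>2[symmetric]) (simp add: power2_eq_square)
    then show ?thesis using n \<sigma>0 by simp
  qed
  \<comment> \<open>A norm that reaches the bound has the extremal singular values, and these sum to
    exactly the bound.\<close>
  have le: "nuclear_norm A \<le> bound"
    using extremal attained by (metis linorder_le_cases order_refl)
  have "nuclear_norm A = bound \<longleftrightarrow> (\<alpha> = 0 \<and> direct_sum_of_cycles n Arcs) \<or>
    (regular n Arcs t \<and> s ! 0 = t \<and> (\<forall>i\<in>{1..<n}. s ! i = \<sigma>) \<and> \<sigma> \<noteq> t)"
    (is "_ \<longleftrightarrow> ?a \<or> ?b")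
  proof
    assume eq: "nuclear_norm A = bound"
    then have s: "s ! 0 = t" "\<forall>i\<in>{1..<n}. s ! i = \<sigma>" using extremal by auto
    have out: "real (outdeg Arcs i) = t" if "i < n" for i
      using mean(2)[OF s(1) that] rows[OF that] by simp
    have "real (indeg Arcs i) = t" if i: "i < n" for i
    proof -
      have "\<alpha> * t + (1 - \<alpha>) * real (indeg Arcs i) = t"
        using mean(3)[OF s(1) i] A_alpha_col_sum[OF assms(4) i, of \<alpha>] out[OF i] by (simp add: A_def)
      then have "(1 - \<alpha>) * real (indeg Arcs i) = (1 - \<alpha>) * t" by (simp add: algebra_simps)
      then show ?thesis using assms(2) by simp
    qed
    with out have reg: "regular n Arcs t" by (simp add: regular_def)
    show "?a \<or> ?b"
    \<comment> \<open>Alternative (b) asks for two distinct values, so the case of equal values must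
      lead to (a).\<close>
    proof (cases "\<sigma> = t")
      case False
      then show ?thesis using reg s by auto
    next
      case True
      then have "F = real n * t^2" using \<sigma>2 by (simp add: algebra_simps)
      moreover have "F = real n * (\<alpha>^2 * t^2 + (1 - \<alpha>)^2 * t)"
        using out t(2) by (simp add: F_def algebra_simps)
      ultimately have "\<alpha>^2 * t^2 + (1 - \<alpha>)^2 * t = t^2" using n by simp
      then have "t * ((1 - \<alpha>) * ((1 + \<alpha>) * t - (1 - \<alpha>))) = 0"
        by (simp add: power2_eq_square algebra_simps)
      then have "(1 + \<alpha>) * t = 1 - \<alpha>" using t assms(2) by simp
      \<comment> \<open>Here \<open>t\<close> is a positive outdegree, hence at least 1. Then
        \<open>1 - \<alpha> = (1 + \<alpha>) * t\<close> is at least \<open>1 + \<alpha>\<close>,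
        which forces \<alpha> = 0.\<close>
      moreover have "1 \<le> t"
        using out[OF n(1)] t(1) by (cases "outdeg Arcs 0") auto
      moreover from this have "\<alpha> \<le> \<alpha> * t" using assms(1) mult_left_mono[of 1 t \<alpha>] by simp
      ultimately have "\<alpha> = 0" "t = 1" using assms(1) by (simp_all add: algebra_simps)
      then show ?thesis
        using one_regular_imp_direct_sum_of_cycles[OF assms(4)] reg by auto
    qed
  next
    assume "?a \<or> ?b"
    then show "nuclear_norm A = bound"
    proof
      assume a: ?a
      then have deg: "outdeg Arcs i = 1" if "i < n" for i
        using direct_sum_of_cycles_degrees(1) that by blast
      then have "a = real n" using degree_sums(3)[OF assms(4)] by (simp add: a_def)
      then have "t = 1" using n by (simp add: t_def)
      moreover have "F = real n" using a deg \<open>a = real n\<close> by (simp add: F_def)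
      ultimately have "\<sigma> = 1" using n by (simp add: \<sigma>_def)
      moreover have "s = replicate n 1"
        using singular_values_direct_sum_of_cycles[OF assms(4)] a by (simp add: s_def A_def)
      ultimately show ?thesis using \<open>t = 1\<close> n by (intro attained) auto
    qed (use attained in auto)
  qed
  then show ?thesis
    using le radicand unfolding bound_def \<sigma>_def Let_def
    by (simp add: A_def s_def t_def F_def a_def power_divide add.commute)
qed

end
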